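(* Let $\psi^\star_{\mathcal{P}_S\mathcal{P}_H}(\cdot)=D_\varphi(\cdot\|\mathcal{P}_S\mathcal{P}_H)$ for some convex functional $\varphi$, and let $\psi_{\mathcal{P}_S\mathcal{P}_H}$ be the Legendre–Fenchel dual of $D_\varphi(\cdot\|\mathcal{P}_S\mathcal{P}_H)$. Assume that, for some convex function $\phi$, $$\psi_{\mathcal{P}_S\mathcal{P}_H}\Big(\lambda\big(L_S(H)-\mathcal{P}_H(L_{\mathcal{P}}(H))\big)\Big)\le\frac{\phi(\lambda)}{n}\quad\text{for every }h\in\mathcal{H}\text{ and }n,\lambda>0.$$ Then $$\text{gen-err}_{\mathcal{P}}(\mathcal{A},S)\le\frac{{\phi^\star}^{-1}\big(nD_\varphi(\mathcal{P}_{SH}\|\mathcal{P}_S\mathcal{P}_H)\big)}{n}.$$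
   Context: For a measure $\mu$ and a function $g$, $\mu(g)=\int g\,d\mu$. $\mathcal{Z}$ is the instance space, $\mathcal{H}$ the hypothesis space, $\mathcal{P}_Z$ a probability measure on $\mathcal{Z}$, and $\ell:\mathcal{H}\times\mathcal{Z}\to\mathbb{R}$ a loss function. $S=(Z_1,\dots,Z_n)$ has law $\mathcal{P}_S=\mathcal{P}_Z^{\otimes n}$ and is the input of a (possibly randomised) learning algorithm $\mathcal{A}:\mathcal{Z}^n\to\mathcal{H}$, with output $H=\mathcal{A}(S)$ of law $\mathcal{P}_H$. $\mathcal{P}_{SH}$ is the joint law of $(S,H)$ induced by $\mathcal{A}$, $\mathcal{P}_S\mathcal{P}_H$ is the product of the marginals, and it is assumed that $\mathcal{P}_{SH}\ll\mathcal{P}_S\mathcal{P}_H$. The risk of $h\in\mathcal{H}$ is $L_{\mathcal{P}}(h)=\mathcal{P}_Z(\ell(h,Z))$; for a sample $S=(z_1,\dots,z_n)$ the empirical risk is $L_S(h)=\frac1n\sum_{i=1}^n\ell(h,z_i)$. The generalisation error is $$\text{gen-err}_{\mathcal{P}}(\mathcal{A},S)=\mathcal{P}_{SH}\big(L_S(\mathcal{A}(S))-L_{\mathcal{P}}(\mathcal{A}(S))\big).$$ The $\varphi$-divergence is $D_\varphi(\nu\|\mu)=\mu\big(\varphi(\tfrac{d\nu}{d\mu})\big)$, with $\tfrac{d\nu}{d\mu}$ the Radon–Nikodym derivative. The Legendre–Fenchel dual of $D_\varphi(\cdot\|\mu)$ is $\psi_\mu(g)=\sup_\nu\{\nu(g)-D_\varphi(\nu\|\mu)\}$,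 the supremum being over measures $\nu$ (for the Kullback–Leibler divergence, $\varphi(x)=x\log x$, restricted to probability measures, $\psi_\mu(g)=\log\mu(e^g)$). $\phi^\star(s)=\sup_{x\in\mathbb{R}}\{sx-\phi(x)\}$ is the Legendre–Fenchel dual of $\phi$, and ${\phi^\star}^{-1}(t)=\inf\{s:\phi^\star(s)\ge t\}$ is its generalised inverse.
   Formalization: It is additionally assumed that the generalised inverse of φ* at nD is not −∞; otherwise the claim reads "real number ≤ −∞" and is false (e.g. φ(λ)=λ²/2 on all of ℝ). A rate φ meant for λ>0 is to be extended by +∞ to negative λ. *)

theory Defs
  imports "HOL-Probability.Probability"
begin

section \<open>Extended-real convex functions, conjugate and generalised inverse\<close>

text \<open>Convexity for functions with values in \<open>(-\<infinity>, \<infinity>]\<close>; the value \<open>\<infinity>\<close> marks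
  the points outside the effective domain. The library's \<^const>\<open>convex_on\<close> only covers real values.\<close>

definition convex_ereal_on :: "real set \<Rightarrow> (real \<Rightarrow> ereal) \<Rightarrow> bool" where
  "convex_ereal_on S f \<longleftrightarrow> convex S \<and> (\<forall>x\<in>S. f x \<noteq> -\<infinity>) \<and>
     (\<forall>x\<in>S. \<forall>y\<in>S. \<forall>t. 0 < t \<and> t < 1 \<longrightarrow>
        f ((1 - t) * x + t * y) \<le> ereal (1 - t) * f x + ereal t * f y)"

definition conjugate :: "(real \<Rightarrow> ereal) \<Rightarrow> real \<Rightarrow> ereal" where
  "conjugate f s = (SUP x. ereal (s * x) - f x)"

text \<open>The infimum is taken in the extended reals: it is \<open>\<infinity>\<close> if no real \<open>s\<close> reaches the level \<open>t\<close>,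
  and \<open>-\<infinity>\<close> if the superlevel set is unbounded below. For \<open>F = conjugate f\<close> and real \<open>t\<close> the latter
  happens whenever \<open>f\<close> is finite at some negative point; a function of a parameter \<open>\<lambda> > 0\<close>
  is therefore to be extended by \<open>\<infinity>\<close> to the negative half-line before it is conjugated.\<close>

definition gen_inverse :: "(real \<Rightarrow> ereal) \<Rightarrow> ereal \<Rightarrow> ereal" where
  "gen_inverse F t = (INF s\<in>{s. t \<le> F s}. ereal s)"

section \<open>Divergences and their Legendre--Fenchel duals\<close>

text \<open>Integral of an extended-real function. The Bochner integral would return \<open>0\<close> for a divergence
  that is \<open>\<infinity>\<close>. For a convex function of the density of a finite measure with respect to a
  probability measure, the negative part has finite integral.\<close>

definition ereal_integral :: "'a measure \<Rightarrow> ('a \<Rightarrow> ereal) \<Rightarrow> ereal" where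
  "ereal_integral M f =
     enn2ereal (\<integral>\<^sup>+x. e2ennreal (f x) \<partial>M) - enn2ereal (\<integral>\<^sup>+x. e2ennreal (- f x) \<partial>M)"

text \<open>\<open>D\<^sub>\<phi>(\<nu> \<parallel> \<mu>)\<close>. The function \<open>\<phi>\<close> is only evaluated on \<open>[0, \<infinity>)\<close>; as in the library's
  \<^const>\<open>absolutely_continuous\<close> and \<^const>\<open>RN_deriv\<close>, the reference measure comes first.\<close>

definition phi_divergence :: "(real \<Rightarrow> ereal) \<Rightarrow> 'a measure \<Rightarrow> 'a measure \<Rightarrow> ereal" where
  "phi_divergence \<phi> \<mu> \<nu> =
     (if absolutely_continuous \<mu> \<nu>
      then ereal_integral \<mu> (\<lambda>x. \<phi> (enn2real (RN_deriv \<mu> \<nu> x)))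
      else \<infinity>)"

definition finite_measures :: "'a measure \<Rightarrow> 'a measure set" where
  "finite_measures \<mu> = {\<nu>. sets \<nu> = sets \<mu> \<and> finite_measure \<nu>}"

definition prob_measures :: "'a measure \<Rightarrow> 'a measure set" where
  "prob_measures \<mu> = {\<nu>. sets \<nu> = sets \<mu> \<and> prob_space \<nu>}"

text \<open>The dual of a functional \<open>D\<close> on the set \<open>N\<close> of measures. Only measures for which
  \<open>\<nu>(g)\<close> is a real number compete, so that the difference is never of the form \<open>\<infinity> - \<infinity>\<close>.\<close>

definition legendre_dual :: "'a measure set \<Rightarrow> ('a measure \<Rightarrow> ereal) \<Rightarrow> ('a \<Rightarrow> real) \<Rightarrow> ereal" where
  "legendre_dual N D g = (SUP \<nu>\<in>{\<nu> \<in> N. integrable \<nu> g}. ereal (\<integral>x. g x \<partial>\<nu>) - D \<nu>)"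

section \<open>Learning algorithms\<close>

definition sample_law :: "'z measure \<Rightarrow> nat \<Rightarrow> (nat \<Rightarrow> 'z) measure" where
  "sample_law P n = PiM {..<n} (\<lambda>_. P)"

text \<open>A randomised algorithm on samples of size \<open>n\<close> is a Markov kernel \<open>K\<close>: given the sample \<open>s\<close>,
  the output has law \<open>K s\<close>. A deterministic algorithm \<open>a\<close> is \<open>\<lambda>s. return MH (a s)\<close>.\<close>

definition joint_law ::
  "'z measure \<Rightarrow> 'h measure \<Rightarrow> nat \<Rightarrow> ((nat \<Rightarrow> 'z) \<Rightarrow> 'h measure) \<Rightarrow> ((nat \<Rightarrow> 'z) \<times> 'h) measure" where
  "joint_law P MH n K =
     sample_law P n \<bind> (\<lambda>s. distr (K s) (sample_law P n \<Otimes>\<^sub>M MH) (\<lambda>h. (s, h)))"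

definition output_law ::
  "'z measure \<Rightarrow> 'h measure \<Rightarrow> nat \<Rightarrow> ((nat \<Rightarrow> 'z) \<Rightarrow> 'h measure) \<Rightarrow> 'h measure" where
  "output_law P MH n K = distr (joint_law P MH n K) MH snd"

definition product_law ::
  "'z measure \<Rightarrow> 'h measure \<Rightarrow> nat \<Rightarrow> ((nat \<Rightarrow> 'z) \<Rightarrow> 'h measure) \<Rightarrow> ((nat \<Rightarrow> 'z) \<times> 'h) measure" where
  "product_law P MH n K = sample_law P n \<Otimes>\<^sub>M output_law P MH n K"

definition risk :: "('h \<Rightarrow> 'z \<Rightarrow> real) \<Rightarrow> 'z measure \<Rightarrow> 'h \<Rightarrow> real" where
  "risk l P h = (\<integral>z. l h z \<partial>P)"

definition emp_risk :: "('h \<Rightarrow> 'z \<Rightarrow> real) \<Rightarrow> nat \<Rightarrow> (nat \<Rightarrow> 'z) \<Rightarrow> 'h \<Rightarrow> real" where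
  "emp_risk l n s h = (\<Sum>i<n. l h (s i)) / real n"

definition gen_err ::
  "('h \<Rightarrow> 'z \<Rightarrow> real) \<Rightarrow> 'z measure \<Rightarrow> 'h measure \<Rightarrow> nat \<Rightarrow> ((nat \<Rightarrow> 'z) \<Rightarrow> 'h measure) \<Rightarrow> real" where
  "gen_err l P MH n K = (\<integral>(s, h). emp_risk l n s h - risk l P h \<partial>joint_law P MH n K)"

end

theory Submission
  imports Defs
begin

text \<open>Write \<open>\<mu>\<close> for the product law, \<open>J\<close> for the joint law and \<open>g\<close> for the centred empirical
  risk, so that the generalisation error is \<open>J(g)\<close>. The duality hypothesis at \<open>J\<close> gives
  \<open>\<theta> n J(g) - \<Phi>(\<theta>) \<le> n D(J)\<close>, but only for \<open>\<theta> > 0\<close>, whereas the conjugate is a supremum over all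
  real \<open>\<theta>\<close>. If some \<open>s < n J(g)\<close> reached the level \<open>n D(J)\<close>, the points where the supremum is
  (almost) attained would be nonpositive or tend to \<open>0\<close>; either way every smaller \<open>s'\<close> would reach that
  level as well, and the generalised inverse would be \<open>-\<infinity>\<close>. If \<open>D(J) = \<infinity>\<close>, the hypothesis at \<open>J\<close>
  is void, and one uses it at laws with densities clamped between positive constants: these have
  finite divergence, and their integrals of \<open>g\<close> converge to \<open>J(g)\<close>.\<close>

section \<open>Lower bounds for generalised inverses of conjugates\<close>

text \<open>Letting the real \<open>B\<close> depend on \<open>e\<close> covers
  \<open>t = \<infinity>\<close>, where the bounds may grow as \<open>e\<close> approaches
  \<open>E\<close>. The strict gap between \<open>s\<close> and \<open>e\<close> is what forces
  witnesses \<open>x > 0\<close> to be small.\<close>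

lemma gen_inverse_conjugate_ge:
  fixes \<Phi> :: "real \<Rightarrow> ereal"
  assumes bound: "\<And>e. e < E \<Longrightarrow> \<exists>B. ereal B \<le> t \<and> (\<forall>x>0. ereal (x * e) - \<Phi> x \<le> ereal B)"
    and bdd: "gen_inverse (conjugate \<Phi>) t \<noteq> -\<infinity>"
  shows "ereal E \<le> gen_inverse (conjugate \<Phi>) t"
proof (rule ccontr)
  assume "\<not> ?thesis"
  then obtain s where st: "t \<le> conjugate \<Phi> s" and "s < E"
    by (auto simp: gen_inverse_def not_le INF_less_iff)
  then obtain e where e: "s < e" "e < E" using dense by blast
  obtain B where Bt: "ereal B \<le> t" and B: "\<And>x. x > 0 \<Longrightarrow> ereal (x * e) - \<Phi> x \<le> ereal B"
    using bound[OF e(2)] by blast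
  have reach: "t \<le> conjugate \<Phi> s'" if s': "s' \<le> s" for s'
  proof (rule dense_le)
    fix y' assume "y' < t"
    then obtain y where y: "y' \<le> ereal y" "ereal y < t"
      by (metis ereal_dense2 less_imp_le)
    define p where "p = s - s'"
    define q where "q = e - s"
    have pq: "0 \<le> p" "0 < q" "0 < p + q" using s' e by (auto simp: p_def q_def)
    \<comment> \<open>The second argument of the maximum is the level above which every witness \<open>x > 0\<close> for \<open>s\<close>
      is so small that moving from \<open>s\<close> to \<open>s'\<close> keeps it above \<open>y\<close>.\<close>
    define c where "c = max y ((B * p + y * q) / (p + q))"
    \<comment> \<open>For real \<open>t\<close>, the second argument of the maximum is a weighted
      mean of \<open>B \<le> t\<close> and \<open>y < t\<close> with positive weight on
      \<open>y\<close>, hence strictly below \<open>t\<close>.\<close>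
    have "ereal c < t"
    proof (cases t)
      case (real r)
      then have r: "B \<le> r" "y < r" using Bt y by auto
      have "B * p + y * q < r * p + r * q"
        by (intro add_le_less_mono mult_right_mono mult_strict_right_mono) (use r pq in auto)
      then show ?thesis using real pq r by (auto simp: c_def divide_simps algebra_simps)
    qed (use y in auto)
    then have "ereal c < conjugate \<Phi> s" using st by (rule less_le_trans)
    then obtain x where x: "ereal c < ereal (x * s) - \<Phi> x"
      by (auto simp: conjugate_def less_SUP_iff mult.commute)
    have "ereal y \<le> ereal (x * s') - \<Phi> x"
    proof (cases "\<Phi> x")
      case (real r)
      then have cx: "c < x * s - r" using x by simp
      \<comment> \<open>For \<open>x > 0\<close>, the bound at \<open>e\<close> limits
        \<open>x * q\<close> to \<open>B - c\<close>, and the choice of \<open>c\<close> turns this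
        into \<open>x * p \<le> c - y\<close>: the loss in passing from \<open>s\<close> to
        \<open>s'\<close> fits into the margin. For \<open>x \<le> 0\<close> moving left loses
        nothing.\<close>
      have "y \<le> x * s' - r"
      proof (cases "x > 0")
        case True
        have "x * e - r \<le> B" using B[OF True] real by simp
        then have xq: "x * q \<le> B - c" using cx by (simp add: q_def algebra_simps)
        have "(B * p + y * q) / (p + q) \<le> c" by (simp add: c_def)
        then have "B * p + y * q \<le> c * p + c * q" using pq by (simp add: divide_simps algebra_simps)
        then have "(B - c) * p \<le> (c - y) * q" by (simp add: algebra_simps)
        moreover have "(x * q) * p \<le> (B - c) * p" using xq pq by (intro mult_right_mono) auto
        ultimately have "(x * p) * q \<le> (c - y) * q" by (simp add: algebra_simps)
        then have "x * p \<le> c - y" using pq by simp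
        then show ?thesis using cx by (simp add: p_def algebra_simps)
      next
        case False
        then have "x * s \<le> x * s'" using s' by (simp add: mult_left_mono_neg)
        moreover have "y \<le> c" by (simp add: c_def)
        ultimately show ?thesis using cx by linarith
      qed
      then show ?thesis using real by simp
    qed (use x in auto)
    also have "\<dots> \<le> conjugate \<Phi> s'"
      unfolding conjugate_def by (rule SUP_upper2[of x]) (auto simp: mult.commute)
    finally show "y' \<le> conjugate \<Phi> s'" using y by (rule_tac order_trans)
  qed
  have "gen_inverse (conjugate \<Phi>) t \<le> ereal r" for r
  proof -
    \<comment> \<open>\<open>reach\<close> speaks only of points up to \<open>s\<close>, hence the
      minimum.\<close>
    have "gen_inverse (conjugate \<Phi>) t \<le> ereal (min r s)"
      unfolding gen_inverse_def by (rule INF_lower) (use reach in auto)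
    also have "\<dots> \<le> ereal r" by simp
    finally show ?thesis .
  qed
  then have "gen_inverse (conjugate \<Phi>) t = -\<infinity>"
    by (rule ereal_bot)
  with bdd show False by contradiction
qed

section \<open>Fenchel's inequality\<close>

lemma legendre_dual_ge:
  assumes "\<nu> \<in> \<N>" "integrable \<nu> g"
  shows "ereal (\<integral>x. g x \<partial>\<nu>) - D \<nu> \<le> legendre_dual \<N> D g"
  unfolding legendre_dual_def by (rule SUP_upper) (use assms in auto)

text \<open>Fenchel's inequality at \<open>\<nu>\<close>, multiplied by \<open>n\<close>. With a
  real bound \<open>C\<close> in place of \<open>D \<nu>\<close>, only
  \<open>\<Phi> \<theta>\<close> can be infinite, and terms can be moved across the
  inequality.\<close>

lemma legendre_dual_scaled_bound:
  fixes \<Phi> :: "real \<Rightarrow> ereal"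
  assumes "\<nu> \<in> \<N>" "integrable \<nu> g" "D \<nu> \<le> ereal C" "n > (0::nat)"
    and dual: "legendre_dual \<N> D (\<lambda>x. \<theta> * g x) \<le> \<Phi> \<theta> / ereal (real n)"
  shows "ereal (\<theta> * (real n * (\<integral>x. g x \<partial>\<nu>))) - \<Phi> \<theta> \<le> ereal (real n * C)"
proof -
  have "ereal (\<theta> * (\<integral>x. g x \<partial>\<nu>)) - ereal C \<le> ereal (\<theta> * (\<integral>x. g x \<partial>\<nu>)) - D \<nu>"
    by (rule ereal_minus_mono) (use assms in auto)
  also have "\<dots> = ereal (\<integral>x. \<theta> * g x \<partial>\<nu>) - D \<nu>" by simp
  also have "\<dots> \<le> legendre_dual \<N> D (\<lambda>x. \<theta> * g x)"
    by (rule legendre_dual_ge) (use assms in auto)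
  also note dual
  finally have le: "ereal (\<theta> * (\<integral>x. g x \<partial>\<nu>)) - ereal C \<le> \<Phi> \<theta> / ereal (real n)" .
  show ?thesis
  proof (cases "\<Phi> \<theta>")
    case (real r)
    with le \<open>n > 0\<close> show ?thesis by (simp add: field_simps)
  \<comment> \<open>The value \<infinity> makes the left side -\<infinity>; the value -\<infinity>
    contradicts \<open>le\<close>, whose left side is real.\<close>
  qed (use le \<open>n > 0\<close> in auto)
qed

section \<open>Divergences of laws with bounded densities\<close>

text \<open>The negative part is simply dropped, so a negative \<open>C\<close> yields only the
  bound \<open>0\<close>.\<close>

lemma ereal_integral_le:
  assumes "prob_space M" "AE x in M. f x \<le> ereal C"
  shows "ereal_integral M f \<le> ereal (max C 0)"
proof -
  interpret prob_space M by fact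
  have "(\<integral>\<^sup>+x. e2ennreal (f x) \<partial>M) \<le> (\<integral>\<^sup>+x. ennreal (max C 0) \<partial>M)"
  proof (rule nn_integral_mono_AE)
    show "AE x in M. e2ennreal (f x) \<le> ennreal (max C 0)"
      using assms(2)
    proof eventually_elim
      case (elim x)
      then have "f x \<le> ereal (max C 0)" by (rule order_trans) simp
      then show ?case by (metis e2ennreal_mono e2ennreal_ereal)
    qed
  qed
  also have "\<dots> = ennreal (max C 0)" by (simp add: emeasure_space_1)
  finally have "enn2ereal (\<integral>\<^sup>+x. e2ennreal (f x) \<partial>M) \<le> enn2ereal (ennreal (max C 0))"
    by (simp add: less_eq_ennreal.rep_eq)
  also have "\<dots> = ereal (max C 0)" by (rule enn2ereal_ennreal) simp
  finally have "enn2ereal (\<integral>\<^sup>+x. e2ennreal (f x) \<partial>M) - enn2ereal (\<integral>\<^sup>+x. e2ennreal (- f x) \<partial>M)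
      \<le> ereal (max C 0) - 0"
    by (intro ereal_minus_mono) auto
  then show ?thesis by (simp add: ereal_integral_def)
qed

lemma convex_ereal_on_le_max:
  assumes "convex_ereal_on {0..} \<phi>" "0 \<le> a" "\<phi> a \<le> ereal C" "\<phi> b \<le> ereal C" "a \<le> x" "x \<le> b"
  shows "\<phi> x \<le> ereal C"
\<comment> \<open>Convexity is stated for \<open>0 < t < 1\<close> only, so the endpoints are
  separate.\<close>
proof (cases "x = a \<or> x = b")
  case False
  define t where "t = (x - a) / (b - a)"
  have t: "0 < t" "t < 1" using assms False by (auto simp: t_def divide_simps)
  have x: "x = (1 - t) * a + t * b" using assms False by (simp add: t_def divide_simps) (simp add: algebra_simps)
  have "\<phi> x \<le> ereal (1 - t) * \<phi> a + ereal t * \<phi> b"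
    unfolding x using assms t by (auto simp: convex_ereal_on_def)
  also have "\<dots> \<le> ereal (1 - t) * ereal C + ereal t * ereal C"
    using t assms by (intro add_mono ereal_mult_left_mono) auto
  also have "\<dots> = ereal C" by (simp add: algebra_simps)
  finally show ?thesis .
qed (use assms in auto)

text \<open>A density with values in \<open>[a, b]\<close> stays away from \<open>0\<close>, where
  \<open>\<phi>\<close> may be \<infinity>, and convexity bounds \<open>\<phi>\<close> on this
  interval by its finite values at the endpoints.\<close>

lemma phi_divergence_density_le:
  assumes "prob_space \<mu>" "convex_ereal_on {0..} \<phi>" "\<And>x. x > 0 \<Longrightarrow> \<phi> x \<noteq> \<infinity>"
    and [measurable]: "w \<in> borel_measurable \<mu>" and "0 < a" "\<And>x. a \<le> w x" "\<And>x. w x \<le> b"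
  shows "\<exists>C. phi_divergence \<phi> \<mu> (density \<mu> (\<lambda>x. ennreal (w x))) \<le> ereal C"
proof -
  interpret prob_space \<mu> by fact
  let ?\<nu> = "density \<mu> (\<lambda>x. ennreal (w x))"
  have ac: "absolutely_continuous \<mu> ?\<nu>"
    by (rule absolutely_continuousI_density) simp
  have ab: "a \<le> b" using assms(6,7) order_trans by blast
  have "\<exists>C. \<phi> y \<le> ereal C" if "y > 0" for y
    using assms(3)[OF that] by (cases "\<phi> y") auto
  then obtain Ca Cb where "\<phi> a \<le> ereal Ca" "\<phi> b \<le> ereal Cb"
    using \<open>0 < a\<close> ab by (meson less_le_trans)
  then have C: "\<phi> a \<le> ereal (max Ca Cb)" "\<phi> b \<le> ereal (max Ca Cb)"
    by (auto simp: le_max_iff_disj)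
  have "AE x in \<mu>. ennreal (w x) = RN_deriv \<mu> ?\<nu> x"
    by (rule RN_deriv_unique) auto
  then have "AE x in \<mu>. \<phi> (enn2real (RN_deriv \<mu> ?\<nu> x)) \<le> ereal (max Ca Cb)"
  proof eventually_elim
    case (elim x)
    have "enn2real (RN_deriv \<mu> ?\<nu> x) = w x"
      using elim[symmetric] assms(5,6) by (metis enn2real_ennreal less_imp_le order_trans)
    then show ?case
      using convex_ereal_on_le_max[OF assms(2) _ C] assms(5-7) by simp
  qed
  from ereal_integral_le[OF assms(1) this] ac
  have "phi_divergence \<phi> \<mu> ?\<nu> \<le> ereal (max (max Ca Cb) 0)"
    unfolding phi_divergence_def by simp
  then show ?thesis by (rule exI)
qed

section \<open>Approximation by clamped densities\<close>

text \<open>Dominated convergence: the lower clamp is at most \<open>1\<close>, so the clamped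
  function is at most \<open>f + 1\<close> and \<open>\<bar>f * g\<bar> + \<bar>g\<bar>\<close>
  dominates.\<close>

lemma clamp_integral_tendsto:
  fixes f g :: "'a \<Rightarrow> real"
  assumes g: "integrable M g" and gf: "integrable M (\<lambda>x. f x * g x)"
    and [measurable]: "f \<in> borel_measurable M" and f: "\<And>x. 0 \<le> f x"
  shows "integrable M (\<lambda>x. max (1 / Suc k) (min (Suc k) (f x)) * g x)"
    and "(\<lambda>k. \<integral>x. max (1 / Suc k) (min (Suc k) (f x)) * g x \<partial>M) \<longlonglongrightarrow> (\<integral>x. f x * g x \<partial>M)"
proof -
  have [measurable]: "g \<in> borel_measurable M" using g by simp
  let ?c = "\<lambda>k x. max (1 / Suc k) (min (Suc k) (f x))"
  have dom: "norm (?c k x * g x) \<le> norm (f x * g x) + norm (g x)" for k x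
  proof -
    have "\<bar>?c k x\<bar> \<le> f x + 1" 
    proof -
      have "1 / real (Suc k) \<le> f x + 1" using f[of x] by (simp add: add_increasing)
      then show ?thesis using f[of x] by (auto simp: abs_if max_def min_def simp del: of_nat_Suc)
    qed
    then have "\<bar>?c k x\<bar> * \<bar>g x\<bar> \<le> (f x + 1) * \<bar>g x\<bar>" by (rule mult_right_mono) simp
    then show ?thesis using f[of x] by (simp add: abs_mult algebra_simps)
  qed
  have I: "integrable M (\<lambda>x. norm (f x * g x) + norm (g x))" using g gf by auto
  show "integrable M (\<lambda>x. ?c k x * g x)"
    by (rule Bochner_Integration.integrable_bound[OF I]) (use dom in \<open>auto intro!: AE_I2 simp del: max.bounded_iff\<close>)
  show "(\<lambda>k. \<integral>x. ?c k x * g x \<partial>M) \<longlonglongrightarrow> (\<integral>x. f x * g x \<partial>M)"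
  proof (rule integral_dominated_convergence[OF _ _ I])
    show "AE x in M. (\<lambda>k. ?c k x * g x) \<longlonglongrightarrow> f x * g x"
    proof (rule AE_I2)
      fix x
      obtain m :: nat where m: "f x \<le> m" using real_arch_simple by blast
      \<comment> \<open>From \<open>k = m\<close> on the upper clamp is inactive at
        \<open>x\<close>; the lower one tends to \<open>0\<close>.\<close>
      have "eventually (\<lambda>k. max (1 / Suc k) (f x) = ?c k x) sequentially"
        using eventually_ge_at_top[of m] by eventually_elim (use m in \<open>auto simp: min_def\<close>)
      moreover have "(\<lambda>k. max (1 / Suc k) (f x)) \<longlonglongrightarrow> max 0 (f x)"
        using LIMSEQ_inverse_real_of_nat by (intro tendsto_max) (auto simp: inverse_eq_divide)
      ultimately have "(\<lambda>k. ?c k x) \<longlonglongrightarrow> f x"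
        using f[of x] by (auto simp: tendsto_cong max_absorb2 intro: Lim_transform_eventually)
      then show "(\<lambda>k. ?c k x * g x) \<longlonglongrightarrow> f x * g x" by (intro tendsto_mult) auto
    qed
  qed (use dom in auto)
qed

text \<open>The density of \<open>J\<close> is clamped and renormalised. Both the integrals of
  \<open>g\<close> and the normalising constants converge, the latter to \<open>1\<close>, so a
  large \<open>k\<close> keeps the integral above \<open>e\<close>.\<close>

lemma exists_finite_phi_divergence_approx:
  fixes g :: "'a \<Rightarrow> real"
  assumes \<phi>: "convex_ereal_on {0..} \<phi>" "\<And>x. x > 0 \<Longrightarrow> \<phi> x \<noteq> \<infinity>"
    and \<mu>: "prob_space \<mu>" and J: "prob_space J" "absolutely_continuous \<mu> J" "sets J = sets \<mu>"
    and g: "integrable \<mu> g" "integrable J g" and e: "e < (\<integral>x. g x \<partial>J)"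
  shows "\<exists>\<nu>\<in>prob_measures \<mu>. integrable \<nu> g \<and> e < (\<integral>x. g x \<partial>\<nu>) \<and> (\<exists>C. phi_divergence \<phi> \<mu> \<nu> \<le> ereal C)"
proof -
  interpret \<mu>: prob_space \<mu> by fact
  interpret J: prob_space J by fact
  define f where "f x = enn2real (RN_deriv \<mu> J x)" for x
  have [measurable]: "f \<in> borel_measurable \<mu>" unfolding f_def by measurable
  have [measurable]: "g \<in> borel_measurable \<mu>" using g by simp
  have f0: "0 \<le> f x" for x by (simp add: f_def)
  \<comment> \<open>\<open>enn2real\<close> sends \<infinity> to \<open>0\<close>; this changes the
    density on a null set only.\<close>
  have "AE x in \<mu>. RN_deriv \<mu> J x \<noteq> \<infinity>"
    using J.sigma_finite_measure_axioms J by (intro \<mu>.RN_deriv_finite) auto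
  then have "AE x in \<mu>. ennreal (f x) = RN_deriv \<mu> J x"
    by eventually_elim (auto simp: f_def less_top)
  then have "density \<mu> f = density \<mu> (RN_deriv \<mu> J)"
    by (intro density_cong) auto
  then have Jf: "J = density \<mu> f" using J by (simp add: \<mu>.density_RN_deriv)
  have fg: "integrable \<mu> (\<lambda>x. f x * g x)" "(\<integral>x. g x \<partial>J) = (\<integral>x. f x * g x \<partial>\<mu>)"
    using g(2) f0 unfolding Jf by (simp_all add: integrable_density integral_density)
  \<comment> \<open>The factor \<open>1\<close> fits the clamping lemma with the constant
    \<open>1\<close> for \<open>g\<close>, which handles the normalising constants
    \<open>Z\<close>.\<close>
  have f1: "integrable \<mu> (\<lambda>x. f x * 1)"
    using J.integrable_const[of "1 :: real"] f0 unfolding Jf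
    by (subst (asm) integrable_density) auto
  have "(\<integral>x. f x * 1 \<partial>\<mu>) = (\<integral>x. 1 \<partial>J)"
    using f0 unfolding Jf by (subst integral_density) auto
  then have f2: "(\<integral>x. f x * 1 \<partial>\<mu>) = 1"
    using J.prob_space by simp
  define c where "c k x = max (1 / Suc k) (min (Suc k) (f x))" for k x
  define Z where "Z k = (\<integral>x. c k x * 1 \<partial>\<mu>)" for k
  have [measurable]: "c k \<in> borel_measurable \<mu>" for k unfolding c_def by measurable
  have c: "1 / Suc k \<le> c k x" "c k x \<le> Suc k" for k x
    by (auto simp: c_def divide_simps simp del: of_nat_Suc) (simp add: algebra_simps)
  have int1: "integrable \<mu> (c k)" for k
    using clamp_integral_tendsto(1)[OF _ f1 _ f0, of k] by (simp add: c_def[abs_def])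
  have intg: "integrable \<mu> (\<lambda>x. c k x * g x)" for k
    unfolding c_def by (rule clamp_integral_tendsto(1)[OF g(1) fg(1) _ f0]) simp
  have limg: "(\<lambda>k. \<integral>x. c k x * g x \<partial>\<mu>) \<longlonglongrightarrow> (\<integral>x. g x \<partial>J)"
    unfolding c_def fg(2) by (rule clamp_integral_tendsto(2)[OF g(1) fg(1) _ f0]) simp
  have limZ: "Z \<longlonglongrightarrow> 1"
    using clamp_integral_tendsto(2)[OF _ f1 _ f0] unfolding Z_def c_def f2 by simp
  have "(\<lambda>k. (\<integral>x. c k x * g x \<partial>\<mu>) / Z k) \<longlonglongrightarrow> (\<integral>x. g x \<partial>J) / 1"
    by (intro tendsto_divide limg limZ) simp
  then have "eventually (\<lambda>k. e < (\<integral>x. c k x * g x \<partial>\<mu>) / Z k) sequentially"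
    by (rule order_tendstoD) (use e in simp)
  then obtain k where k: "e < (\<integral>x. c k x * g x \<partial>\<mu>) / Z k"
    by (auto simp: eventually_sequentially)
  have "1 / Suc k = (\<integral>x. 1 / Suc k \<partial>\<mu>)" using \<mu>.prob_space by simp
  also have "\<dots> \<le> Z k" unfolding Z_def using int1 c by (intro integral_mono) auto
  finally have Z0: "0 < Z k" by (smt (verit) divide_pos_pos of_nat_0_less_iff zero_less_Suc zero_less_one)
  define w where "w x = c k x / Z k" for x
  have [measurable]: "w \<in> borel_measurable \<mu>" unfolding w_def by measurable
  have w: "1 / Suc k / Z k \<le> w x" "w x \<le> Suc k / Z k" for x
    unfolding w_def by (rule divide_right_mono[OF c(1)] divide_right_mono[OF c(2)], use Z0 in simp)+
  have w0: "0 \<le> w x" for x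
    by (rule order_trans[OF _ w(1)]) (use Z0 in simp)
  have wint: "integrable \<mu> w" unfolding w_def using int1 by simp
  have "(\<integral>x. w x \<partial>\<mu>) = 1" using Z0 by (simp add: w_def) (simp add: Z_def)
  then have "(\<integral>\<^sup>+x. ennreal (w x) \<partial>\<mu>) = 1"
    using wint w0 by (subst nn_integral_eq_integral) auto
  then have "prob_space (density \<mu> w)"
    by (intro prob_spaceI) (simp add: emeasure_density cong: nn_integral_cong)
  moreover have "integrable (density \<mu> w) g"
    using w0 intg[of k] by (simp add: integrable_density w_def)
  moreover have "(\<integral>x. g x \<partial>density \<mu> w) = (\<integral>x. c k x * g x \<partial>\<mu>) / Z k"
    using w0 by (simp add: integral_density w_def)
  moreover have "\<exists>C. phi_divergence \<phi> \<mu> (density \<mu> w) \<le> ereal C"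
    by (rule phi_divergence_density_le[OF \<mu> \<phi> _ _ w]) (use Z0 in auto)
  ultimately show ?thesis using k by (intro bexI[of _ "density \<mu> w"]) (auto simp: prob_measures_def)
qed

section \<open>The inequality for a general pair of laws\<close>

text \<open>This is the bound freed of the learning setting. The class \<open>\<N>\<close> must
  contain the probability measures, since \<open>J\<close> and its approximants serve as test laws
  in the dual.\<close>

lemma legendre_dual_gen_inverse:
  fixes \<Phi> :: "real \<Rightarrow> ereal" and g :: "'a \<Rightarrow> real"
  assumes \<phi>: "convex_ereal_on {0..} \<phi>" "\<And>x. x > 0 \<Longrightarrow> \<phi> x \<noteq> \<infinity>"
    and \<mu>: "prob_space \<mu>" and J: "prob_space J" "absolutely_continuous \<mu> J" "sets J = sets \<mu>"
    and g: "integrable \<mu> g" "integrable J g"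
    and N: "prob_measures \<mu> \<subseteq> \<N>" and n: "n > (0::nat)"
    and dual: "\<And>\<theta>. \<theta> > 0 \<Longrightarrow> legendre_dual \<N> (phi_divergence \<phi> \<mu>) (\<lambda>x. \<theta> * g x) \<le> \<Phi> \<theta> / ereal (real n)"
    and bdd: "gen_inverse (conjugate \<Phi>) (ereal (real n) * phi_divergence \<phi> \<mu> J) \<noteq> -\<infinity>"
  shows "ereal (\<integral>x. g x \<partial>J)
    \<le> gen_inverse (conjugate \<Phi>) (ereal (real n) * phi_divergence \<phi> \<mu> J) / ereal (real n)"
proof -
  let ?D = "phi_divergence \<phi> \<mu>"
  let ?t = "ereal (real n) * ?D J"
  have JN: "J \<in> \<N>" using J N by (auto simp: prob_measures_def)
  have "ereal (real n * (\<integral>x. g x \<partial>J)) \<le> gen_inverse (conjugate \<Phi>) ?t"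
  proof (rule gen_inverse_conjugate_ge[OF _ bdd])
    fix e assume e: "e < real n * (\<integral>x. g x \<partial>J)"
    \<comment> \<open>The test law is \<open>J\<close> itself if its divergence is real. If that is
      \<infinity>, so is the level \<open>?t\<close>, and any approximant with a real bound
      \<open>C\<close> will do.\<close>
    obtain \<nu> C where \<nu>: "\<nu> \<in> \<N>" "integrable \<nu> g" "?D \<nu> \<le> ereal C"
      "e \<le> real n * (\<integral>x. g x \<partial>\<nu>)" "ereal (real n * C) \<le> ?t"
    proof (cases "?D J")
      case (real r)
      then show thesis using that[OF JN g(2), of r] e by simp
    next
      case PInf
      have "e / real n < (\<integral>x. g x \<partial>J)" using e n by (simp add: field_simps)
      from exists_finite_phi_divergence_approx[OF \<phi> \<mu> J g this] obtain \<nu> C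
        where "\<nu> \<in> prob_measures \<mu>" "integrable \<nu> g" "e / real n < (\<integral>x. g x \<partial>\<nu>)" "?D \<nu> \<le> ereal C"
        by blast
      then show thesis using that[of \<nu> C] N n PInf by (auto simp: field_simps)
    next
      case MInf
      \<comment> \<open>Every real reaches the level -\<infinity>, so this case contradicts
        \<open>bdd\<close>.\<close>
      have "gen_inverse (conjugate \<Phi>) (-\<infinity>) \<le> ereal r" for r
        unfolding gen_inverse_def by (rule INF_lower) simp
      then have "gen_inverse (conjugate \<Phi>) (-\<infinity>) = -\<infinity>" by (rule ereal_bot)
      then show thesis using bdd MInf n by simp
    qed
    have "ereal (x * e) - \<Phi> x \<le> ereal (real n * C)" if "x > 0" for x
    proof -
      have "ereal (x * e) - \<Phi> x \<le> ereal (x * (real n * (\<integral>y. g y \<partial>\<nu>))) - \<Phi> x"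
        using \<nu>(4) that by (intro ereal_minus_mono) auto
      also have "\<dots> \<le> ereal (real n * C)"
        by (rule legendre_dual_scaled_bound[where g = g and \<N> = \<N> and D = ?D and \<Phi> = \<Phi> and \<theta> = x, OF \<nu>(1-3) n dual[OF that]])
      finally show ?thesis .
    qed
    with \<nu>(5) show "\<exists>B. ereal B \<le> ?t \<and> (\<forall>x>0. ereal (x * e) - \<Phi> x \<le> ereal B)" by blast
  qed
  then show ?thesis using n by (subst ereal_le_divide_pos) auto
qed

section \<open>Laws induced by a learning algorithm\<close>

lemma prob_space_sample_law: "prob_space P \<Longrightarrow> prob_space (sample_law P n)"
  unfolding sample_law_def by (rule prob_space_PiM)

text \<open>Pairing the output with the sample is again a Markov kernel, and binding preserves
  probability measures. Membership in \<open>prob_algebra\<close> gives the sigma-algebra and the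
  total mass at once.\<close>

lemma joint_law_in_prob_algebra:
  assumes "prob_space P" and K: "K \<in> sample_law P n \<rightarrow>\<^sub>M prob_algebra MH"
  shows "joint_law P MH n K \<in> space (prob_algebra (sample_law P n \<Otimes>\<^sub>M MH))"
proof -
  have "(\<lambda>s. distr (K s) (sample_law P n \<Otimes>\<^sub>M MH) (Pair s))
      \<in> sample_law P n \<rightarrow>\<^sub>M prob_algebra (sample_law P n \<Otimes>\<^sub>M MH)"
    using K by (rule measurable_distr_prob_space2) simp
  then have "(\<lambda>M. M \<bind> (\<lambda>s. distr (K s) (sample_law P n \<Otimes>\<^sub>M MH) (Pair s)))
      \<in> prob_algebra (sample_law P n) \<rightarrow>\<^sub>M prob_algebra (sample_law P n \<Otimes>\<^sub>M MH)"
    by (rule measurable_bind_prob_space[OF measurable_ident, unfolded id_def])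
  then show ?thesis
    unfolding joint_law_def
    by (rule measurable_space) (simp add: space_prob_algebra prob_space_sample_law assms)
qed

lemma sets_joint_law:
  "prob_space P \<Longrightarrow> K \<in> sample_law P n \<rightarrow>\<^sub>M prob_algebra MH \<Longrightarrow>
    sets (joint_law P MH n K) = sets (sample_law P n \<Otimes>\<^sub>M MH)"
  by (drule (1) joint_law_in_prob_algebra) (simp add: space_prob_algebra)

lemma prob_space_joint_law:
  "prob_space P \<Longrightarrow> K \<in> sample_law P n \<rightarrow>\<^sub>M prob_algebra MH \<Longrightarrow> prob_space (joint_law P MH n K)"
  by (drule (1) joint_law_in_prob_algebra) (simp add: space_prob_algebra)

lemma prob_space_output_law:
  assumes "prob_space P" "K \<in> sample_law P n \<rightarrow>\<^sub>M prob_algebra MH"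
  shows "prob_space (output_law P MH n K)"
  unfolding output_law_def
  by (intro prob_space.prob_space_distr prob_space_joint_law assms)
     (simp cong: measurable_cong_sets add: measurable_cong_sets[OF sets_joint_law[OF assms] refl])

lemma sets_output_law [simp]: "sets (output_law P MH n K) = sets MH"
  by (simp add: output_law_def)

text \<open>Under the product law each \<open>s i\<close> is independent of the output and has law
  \<open>P\<close>, so every summand inherits integrability from \<open>l\<close>, up to swapping
  the factors.\<close>

lemma integrable_emp_risk_product_law:
  assumes P: "prob_space P" and K: "K \<in> sample_law P n \<rightarrow>\<^sub>M prob_algebra MH"
    and l: "integrable (output_law P MH n K \<Otimes>\<^sub>M P) (\<lambda>(h, z). l h z)"
  shows "integrable (product_law P MH n K) (\<lambda>(s, h). emp_risk l n s h)"
proof -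
  let ?H = "output_law P MH n K" and ?S = "sample_law P n"
  interpret P: prob_space P by fact
  interpret H: prob_space ?H by (rule prob_space_output_law[OF P K])
  interpret S: prob_space ?S by (rule prob_space_sample_law[OF P])
  interpret HP: pair_sigma_finite ?H P ..
  have "integrable (product_law P MH n K) (\<lambda>(s, h). l h (s i))" if "i < n" for i
  proof -
    have [measurable]: "(\<lambda>s. s i) \<in> ?S \<rightarrow>\<^sub>M P" using that by (simp add: sample_law_def)
    have "distr ?S P (\<lambda>s. s i) = P"
      using distr_PiM_component[of "{..<n}" "\<lambda>_. P" i] that P by (simp add: sample_law_def)
    then have eq: "P \<Otimes>\<^sub>M ?H = distr (?S \<Otimes>\<^sub>M ?H) (P \<Otimes>\<^sub>M ?H) (\<lambda>(s, h). (s i, h))"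
      using pair_measure_distr[of "\<lambda>s. s i" ?S P "\<lambda>h. h" ?H ?H] H.sigma_finite_measure_axioms
      by (simp add: distr_id2 id_def)
    have "integrable (P \<Otimes>\<^sub>M ?H) (\<lambda>(z, h). l h z)"
      using HP.integrable_product_swap[OF l] by (simp add: case_prod_beta)
    then have "integrable (distr (?S \<Otimes>\<^sub>M ?H) (P \<Otimes>\<^sub>M ?H) (\<lambda>(s, h). (s i, h))) (\<lambda>(z, h). l h z)"
      using eq by simp
    from integrable_distr[OF _ this] show ?thesis
      by (simp add: product_law_def case_prod_unfold)
  qed
  then have "integrable (product_law P MH n K) (\<lambda>x. (\<Sum>i<n. (case x of (s, h) \<Rightarrow> l h (s i))) / real n)"
    by (intro integrable_divide Bochner_Integration.integrable_sum) simp
  then show ?thesis by (simp add: emp_risk_def case_prod_unfold)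
qed

text \<open>The second marginal of the joint law is the output law. Replacing the risk of the output
  by its mean therefore keeps the integral, and yields the constant centring of the duality
  hypothesis.\<close>

lemma gen_err_eq:
  assumes P: "prob_space P" and K: "K \<in> sample_law P n \<rightarrow>\<^sub>M prob_algebra MH"
    and l: "integrable (output_law P MH n K \<Otimes>\<^sub>M P) (\<lambda>(h, z). l h z)"
    and e: "integrable (joint_law P MH n K) (\<lambda>(s, h). emp_risk l n s h)"
  shows "gen_err l P MH n K = (\<integral>(s, h). emp_risk l n s h - (\<integral>h'. risk l P h' \<partial>output_law P MH n K) \<partial>joint_law P MH n K)"
proof -
  let ?H = "output_law P MH n K" and ?J = "joint_law P MH n K"
  interpret P: prob_space P by fact
  interpret H: prob_space ?H by (rule prob_space_output_law[OF P K])
  interpret J: prob_space ?J by (rule prob_space_joint_law[OF P K])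
  interpret HP: pair_sigma_finite ?H P ..
  have snd: "snd \<in> ?J \<rightarrow>\<^sub>M MH"
    by (simp add: measurable_cong_sets[OF sets_joint_law[OF P K] refl])
  \<comment> \<open>Fubini's theorem, as the risk is the inner integral of \<open>l\<close>.\<close>
  have r: "integrable ?H (risk l P)"
    using HP.integrable_fst'[OF l] by (simp add: risk_def[abs_def])
  then have rb: "risk l P \<in> borel_measurable MH"
    by (subst measurable_cong_sets[OF sets_output_law[symmetric] refl]) (rule borel_measurable_integrable)
  have rJ: "integrable ?J (\<lambda>x. risk l P (snd x))"
    using r unfolding output_law_def by (rule integrable_distr[OF snd])
  have rE: "(\<integral>h. risk l P h \<partial>?H) = (\<integral>x. risk l P (snd x) \<partial>?J)"
    unfolding output_law_def using snd rb by (rule integral_distr)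
  show ?thesis
    using e rJ J.prob_space by (simp add: gen_err_def case_prod_unfold rE)
qed

section \<open>The bound on the generalisation error\<close>

text \<open>The conclusion, with its real left side, forces the generalised inverse to differ from
  -\<infinity>. That value does occur, for instance if \<open>\<Phi> 0 = 0\<close> and the level is
  \<open>0\<close>: the conjugate is then nonnegative everywhere.\<close>

theorem corollary2:
  fixes P :: "'z measure"
    and MH :: "'h measure"
    and l :: "'h \<Rightarrow> 'z \<Rightarrow> real"
    and A :: "nat \<Rightarrow> (nat \<Rightarrow> 'z) \<Rightarrow> 'h measure"
    and \<phi> \<Phi> :: "real \<Rightarrow> ereal"
    and N :: "((nat \<Rightarrow> 'z) \<times> 'h) measure \<Rightarrow> ((nat \<Rightarrow> 'z) \<times> 'h) measure set"
    and n :: nat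
  assumes "prob_space P"
    and "(\<lambda>(h, z). l h z) \<in> borel_measurable (MH \<Otimes>\<^sub>M P)"
    and "\<And>m. m > 0 \<Longrightarrow> A m \<in> sample_law P m \<rightarrow>\<^sub>M prob_algebra MH"
    and "\<And>m. m > 0 \<Longrightarrow> absolutely_continuous (product_law P MH m (A m)) (joint_law P MH m (A m))"
    and "\<And>m. m > 0 \<Longrightarrow> integrable (output_law P MH m (A m) \<Otimes>\<^sub>M P) (\<lambda>(h, z). l h z)"
    and "\<And>m. m > 0 \<Longrightarrow> integrable (joint_law P MH m (A m)) (\<lambda>(s, h). emp_risk l m s h)"
    and "convex_ereal_on {0..} \<phi>" and "\<And>x. x > 0 \<Longrightarrow> \<phi> x \<noteq> \<infinity>"
    and "N = finite_measures \<or> N = prob_measures"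
    and "convex_ereal_on UNIV \<Phi>"
    and "\<And>m \<theta>. m > 0 \<Longrightarrow> \<theta> > 0 \<Longrightarrow>
      legendre_dual (N (product_law P MH m (A m))) (phi_divergence \<phi> (product_law P MH m (A m)))
        (\<lambda>(s, h). \<theta> * (emp_risk l m s h - (\<integral>h'. risk l P h' \<partial>output_law P MH m (A m))))
      \<le> \<Phi> \<theta> / ereal (real m)"
    and "n > 0"
    and "gen_inverse (conjugate \<Phi>)
        (ereal (real n) * phi_divergence \<phi> (product_law P MH n (A n)) (joint_law P MH n (A n))) \<noteq> -\<infinity>"
  shows "ereal (gen_err l P MH n (A n)) \<le>
    gen_inverse (conjugate \<Phi>)
      (ereal (real n) * phi_divergence \<phi> (product_law P MH n (A n)) (joint_law P MH n (A n)))
    / ereal (real n)"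
proof -
  let ?K = "A n" and ?c = "\<integral>h'. risk l P h' \<partial>output_law P MH n (A n)"
  let ?\<mu> = "product_law P MH n ?K" and ?J = "joint_law P MH n ?K"
  let ?g = "\<lambda>(s, h). emp_risk l n s h - ?c"
  note K = assms(3)[OF \<open>n > 0\<close>]
  interpret J: prob_space ?J by (rule prob_space_joint_law[OF assms(1) K])
  have \<mu>: "prob_space ?\<mu>"
    unfolding product_law_def
    by (intro prob_space_pair prob_space_sample_law prob_space_output_law assms(1) K)
  interpret \<mu>: prob_space ?\<mu> by (rule \<mu>)
  have sets: "sets ?J = sets ?\<mu>"
    by (simp add: sets_joint_law[OF assms(1) K] product_law_def sets_pair_measure_cong[OF refl sets_output_law])
  have N: "prob_measures ?\<mu> \<subseteq> N ?\<mu>"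
    using assms(9) by (auto simp: prob_measures_def finite_measures_def prob_space.finite_measure)
  have g\<mu>: "integrable ?\<mu> ?g"
    using integrable_emp_risk_product_law[OF assms(1) K assms(5)[OF \<open>n > 0\<close>]]
    by (simp add: case_prod_unfold)
  have gJ: "integrable ?J ?g"
    using assms(6)[OF \<open>n > 0\<close>] by (simp add: case_prod_unfold)
  have dual: "legendre_dual (N ?\<mu>) (phi_divergence \<phi> ?\<mu>) (\<lambda>x. \<theta> * ?g x) \<le> \<Phi> \<theta> / ereal (real n)"
    if "\<theta> > 0" for \<theta>
    using assms(11)[OF \<open>n > 0\<close> that] by (simp add: case_prod_unfold)
  show ?thesis
    unfolding gen_err_eq[OF assms(1) K assms(5,6)[OF \<open>n > 0\<close>]]
    by (rule legendre_dual_gen_inverse[OF assms(7,8) \<mu> J.prob_space_axioms assms(4)[OF \<open>n > 0\<close>]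
          sets g\<mu> gJ N \<open>n > 0\<close> dual assms(13)])
qed

end
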